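(* Let $\mu \in \mathfrak{M}_{x}(\mathcal{U})$ and let $M \prec \mathcal{U}$ be a small model. Then $\mu$ is finitely satisfiable in $M$ if and only if $\mu$ is in the closure of $\mathrm{conv}(M^{x})$ (viewed as a subset of $\mathfrak{M}_{x}(\mathcal{U})$).
   Context: $\mathcal{U}$ is a sufficiently saturated model of an arbitrary first-order theory in a language $\mathcal{L}$, and $x$ is a finite tuple of variables. $\mathcal{L}_x(\mathcal{U})$ is the Boolean algebra of formulas in $x$ with parameters from $\mathcal{U}$ (up to equivalence), and $\mathfrak{M}_x(\mathcal{U})$ is the set of global Keisler measures, i.e. finitely additive probability measures on $\mathcal{L}_x(\mathcal{U})$, with the topology induced from $[0,1]^{\mathcal{L}_x(\mathcal{U})}$. It is a closed convex subset of the real topological vector space of bounded real-valued measures. $\mu\in\mathfrak{M}_x(\mathcal{U})$ is finitely satisfiable in $M$ if whenever $\mu(\varphi(x))>0$ for some $\varphi(x)\in\mathcal{L}_x(\mathcal{U})$, there is $a\in M^x$ with $\mathcal{U}\models\varphi(a)$. $M^x$ (the set of $x$-tuples from $M$) is identified with $\{\delta_a:a\in M^x\}\subseteq\mathfrak{M}_x(\mathcal{U})$, where $\delta_a(\varphi(x))=1$ if $\mathcal{U}\models\varphi(a)$ and $0$ otherwise, and $\mathrm{conv}(M^x)$ is its convex hull. *)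

theory Defs
  imports "HOL-Analysis.Analysis" "HOL-Library.Function_Algebras"
begin

unbundle cardinal_syntax

text \<open>
  A language assigns an arity to each of its symbols; the symbols of the language are those
  elements of the ambient types on which the arity maps are defined. Constants are the
  function symbols of arity 0.
\<close>

record ('f, 'r) lang =
  fun_arity :: "'f \<rightharpoonup> nat"
  rel_arity :: "'r \<rightharpoonup> nat"

definition symbols :: "('f, 'r) lang \<Rightarrow> ('f + 'r) set" where
  "symbols L = dom (fun_arity L) <+> dom (rel_arity L)"

text \<open>
  Terms and formulas may contain parameters, i.e. elements of a structure used as names for
  themselves. Variables are natural numbers.
\<close>

datatype ('f, 'u) trm =
    Var nat
  | Param 'u
  | Fun 'f "('f, 'u) trm list"

datatype ('f, 'r, 'u) fm =
    Bot
  | Eq "('f, 'u) trm" "('f, 'u) trm"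
  | Rel 'r "('f, 'u) trm list"
  | Neg "('f, 'r, 'u) fm"
  | Disj "('f, 'r, 'u) fm" "('f, 'r, 'u) fm"
  | Ex nat "('f, 'r, 'u) fm"

abbreviation Top :: "('f, 'r, 'u) fm" where
  "Top \<equiv> Neg Bot"

abbreviation Conj :: "('f, 'r, 'u) fm \<Rightarrow> ('f, 'r, 'u) fm \<Rightarrow> ('f, 'r, 'u) fm" where
  "Conj \<phi> \<psi> \<equiv> Neg (Disj (Neg \<phi>) (Neg \<psi>))"

fun trm_vars :: "('f, 'u) trm \<Rightarrow> nat set" where
  "trm_vars (Var v) = {v}"
| "trm_vars (Param u) = {}"
| "trm_vars (Fun f ts) = (\<Union>t\<in>set ts. trm_vars t)"

fun trm_params :: "('f, 'u) trm \<Rightarrow> 'u set" where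
  "trm_params (Var v) = {}"
| "trm_params (Param u) = {u}"
| "trm_params (Fun f ts) = (\<Union>t\<in>set ts. trm_params t)"

fun wf_trm :: "('f, 'r) lang \<Rightarrow> ('f, 'u) trm \<Rightarrow> bool" where
  "wf_trm L (Var v) \<longleftrightarrow> True"
| "wf_trm L (Param u) \<longleftrightarrow> True"
| "wf_trm L (Fun f ts) \<longleftrightarrow> fun_arity L f = Some (length ts) \<and> (\<forall>t\<in>set ts. wf_trm L t)"

primrec free_vars :: "('f, 'r, 'u) fm \<Rightarrow> nat set" where
  "free_vars Bot = {}"
| "free_vars (Eq s t) = trm_vars s \<union> trm_vars t"
| "free_vars (Rel r ts) = (\<Union>t\<in>set ts. trm_vars t)"
| "free_vars (Neg \<phi>) = free_vars \<phi>"
| "free_vars (Disj \<phi> \<psi>) = free_vars \<phi> \<union> free_vars \<psi>"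
| "free_vars (Ex v \<phi>) = free_vars \<phi> - {v}"

primrec params :: "('f, 'r, 'u) fm \<Rightarrow> 'u set" where
  "params Bot = {}"
| "params (Eq s t) = trm_params s \<union> trm_params t"
| "params (Rel r ts) = (\<Union>t\<in>set ts. trm_params t)"
| "params (Neg \<phi>) = params \<phi>"
| "params (Disj \<phi> \<psi>) = params \<phi> \<union> params \<psi>"
| "params (Ex v \<phi>) = params \<phi>"

primrec wf_fm :: "('f, 'r) lang \<Rightarrow> ('f, 'r, 'u) fm \<Rightarrow> bool" where
  "wf_fm L Bot \<longleftrightarrow> True"
| "wf_fm L (Eq s t) \<longleftrightarrow> wf_trm L s \<and> wf_trm L t"
| "wf_fm L (Rel r ts) \<longleftrightarrow> rel_arity L r = Some (length ts) \<and> (\<forall>t\<in>set ts. wf_trm L t)"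
| "wf_fm L (Neg \<phi>) \<longleftrightarrow> wf_fm L \<phi>"
| "wf_fm L (Disj \<phi> \<psi>) \<longleftrightarrow> wf_fm L \<phi> \<and> wf_fm L \<psi>"
| "wf_fm L (Ex v \<phi>) \<longleftrightarrow> wf_fm L \<phi>"

definition formulas :: "('f, 'r) lang \<Rightarrow> 'u set \<Rightarrow> nat set \<Rightarrow> ('f, 'r, 'u) fm set" where
  "formulas L A V = {\<phi>. wf_fm L \<phi> \<and> params \<phi> \<subseteq> A \<and> free_vars \<phi> \<subseteq> V}"


record ('f, 'r, 'u) struct =
  univ :: "'u set"
  fun_int :: "'f \<Rightarrow> 'u list \<Rightarrow> 'u"
  rel_int :: "'r \<Rightarrow> 'u list \<Rightarrow> bool"

text \<open>
  Only the values of the interpretations at symbols of \<open>L\<close> and at lists of the right length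
  of elements of the universe are meaningful.
\<close>

definition is_struct :: "('f, 'r) lang \<Rightarrow> ('f, 'r, 'u) struct \<Rightarrow> bool" where
  "is_struct L S \<longleftrightarrow> univ S \<noteq> {} \<and>
     (\<forall>f n as. fun_arity L f = Some n \<longrightarrow> length as = n \<longrightarrow> set as \<subseteq> univ S
        \<longrightarrow> fun_int S f as \<in> univ S)"

primrec eval_trm :: "('f, 'r, 'u) struct \<Rightarrow> (nat \<Rightarrow> 'u) \<Rightarrow> ('f, 'u) trm \<Rightarrow> 'u" where
  "eval_trm S e (Var v) = e v"
| "eval_trm S e (Param u) = u"
| "eval_trm S e (Fun f ts) = fun_int S f (map (eval_trm S e) ts)"

primrec sat :: "('f, 'r, 'u) struct \<Rightarrow> (nat \<Rightarrow> 'u) \<Rightarrow> ('f, 'r, 'u) fm \<Rightarrow> bool" where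
  "sat S e Bot \<longleftrightarrow> False"
| "sat S e (Eq s t) \<longleftrightarrow> eval_trm S e s = eval_trm S e t"
| "sat S e (Rel r ts) \<longleftrightarrow> rel_int S r (map (eval_trm S e) ts)"
| "sat S e (Neg \<phi>) \<longleftrightarrow> \<not> sat S e \<phi>"
| "sat S e (Disj \<phi> \<psi>) \<longleftrightarrow> sat S e \<phi> \<or> sat S e \<psi>"
| "sat S e (Ex v \<phi>) \<longleftrightarrow> (\<exists>u\<in>univ S. sat S (e(v := u)) \<phi>)"

text \<open>
  A tuple of variables is the set \<open>V\<close> of its members, and \<open>tuples V A\<close> is \<open>A\<close> to the power
  \<open>V\<close>: a tuple of values is a function on \<open>V\<close>. It may serve as the assignment when evaluating
  a formula with free variables in \<open>V\<close>, since its (undefined) values outside \<open>V\<close> are then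
  irrelevant.
\<close>

definition tuples :: "nat set \<Rightarrow> 'u set \<Rightarrow> (nat \<Rightarrow> 'u) set" where
  "tuples V A = (V \<rightarrow>\<^sub>E A)"

definition is_theory :: "('f, 'r) lang \<Rightarrow> ('f, 'r, 'u) fm set \<Rightarrow> bool" where
  "is_theory L T \<longleftrightarrow> T \<subseteq> formulas L {} {}"

definition is_model :: "('f, 'r) lang \<Rightarrow> ('f, 'r, 'u) fm set \<Rightarrow> ('f, 'r, 'u) struct \<Rightarrow> bool" where
  "is_model L T S \<longleftrightarrow> is_struct L S \<and> (\<forall>\<phi>\<in>T. \<forall>a\<in>tuples {} (univ S). sat S a \<phi>)"

definition elementary_substruct ::
    "('f, 'r) lang \<Rightarrow> ('f, 'r, 'u) struct \<Rightarrow> ('f, 'r, 'u) struct \<Rightarrow> bool" where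
  "elementary_substruct L M U \<longleftrightarrow>
     is_struct L M \<and> univ M \<subseteq> univ U \<and>
     (\<forall>f n as. fun_arity L f = Some n \<longrightarrow> length as = n \<longrightarrow> set as \<subseteq> univ M
        \<longrightarrow> fun_int M f as = fun_int U f as) \<and>
     (\<forall>r n as. rel_arity L r = Some n \<longrightarrow> length as = n \<longrightarrow> set as \<subseteq> univ M
        \<longrightarrow> rel_int M r as = rel_int U r as) \<and>
     (\<forall>V. finite V \<longrightarrow> (\<forall>\<phi>\<in>formulas L {} V. \<forall>a\<in>tuples V (univ M). sat M a \<phi> \<longleftrightarrow> sat U a \<phi>))"

text \<open>Types in a single variable suffice to define saturation.\<close>

definition saturated :: "('f, 'r) lang \<Rightarrow> 'k rel \<Rightarrow> ('f, 'r, 'u) struct \<Rightarrow> bool" where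
  "saturated L \<kappa> U \<longleftrightarrow>
     (\<forall>A v p. A \<subseteq> univ U \<longrightarrow> |A| <o \<kappa> \<longrightarrow> p \<subseteq> formulas L A {v} \<longrightarrow>
        (\<forall>q. finite q \<longrightarrow> q \<subseteq> p \<longrightarrow> (\<exists>a\<in>tuples {v} (univ U). \<forall>\<phi>\<in>q. sat U a \<phi>)) \<longrightarrow>
        (\<exists>a\<in>tuples {v} (univ U). \<forall>\<phi>\<in>p. sat U a \<phi>))"


text \<open>
  The Boolean algebra of formulas in \<open>x\<close> with parameters from \<open>U\<close> is the quotient of the set
  of such formulas by equivalence in \<open>U\<close>.
\<close>

definition fm_equiv ::
    "('f, 'r) lang \<Rightarrow> ('f, 'r, 'u) struct \<Rightarrow> nat set \<Rightarrow> ('f, 'r, 'u) fm rel" where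
  "fm_equiv L U x =
     {(\<phi>, \<psi>). \<phi> \<in> formulas L (univ U) x \<and> \<psi> \<in> formulas L (univ U) x \<and>
        (\<forall>a\<in>tuples x (univ U). sat U a \<phi> \<longleftrightarrow> sat U a \<psi>)}"

definition fm_algebra ::
    "('f, 'r) lang \<Rightarrow> ('f, 'r, 'u) struct \<Rightarrow> nat set \<Rightarrow> ('f, 'r, 'u) fm set set" where
  "fm_algebra L U x = formulas L (univ U) x // fm_equiv L U x"

definition fm_class ::
    "('f, 'r) lang \<Rightarrow> ('f, 'r, 'u) struct \<Rightarrow> nat set \<Rightarrow> ('f, 'r, 'u) fm \<Rightarrow> ('f, 'r, 'u) fm set" where
  "fm_class L U x \<phi> = fm_equiv L U x `` {\<phi>}"

text \<open>
  Finitely additive probability measures on the Boolean algebra; the operations of the algebra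
  are those induced by the connectives on representatives.
\<close>

definition keisler_measures ::
    "('f, 'r) lang \<Rightarrow> ('f, 'r, 'u) struct \<Rightarrow> nat set \<Rightarrow> (('f, 'r, 'u) fm set \<Rightarrow> real) set" where
  "keisler_measures L U x =
     {\<mu> \<in> fm_algebra L U x \<rightarrow>\<^sub>E {0..1}.
        \<mu> (fm_class L U x Top) = 1 \<and>
        (\<forall>\<phi>\<in>formulas L (univ U) x. \<forall>\<psi>\<in>formulas L (univ U) x.
           fm_class L U x (Conj \<phi> \<psi>) = fm_class L U x Bot \<longrightarrow>
           \<mu> (fm_class L U x (Disj \<phi> \<psi>)) = \<mu> (fm_class L U x \<phi>) + \<mu> (fm_class L U x \<psi>))}"

definition keisler_topology ::
    "('f, 'r) lang \<Rightarrow> ('f, 'r, 'u) struct \<Rightarrow> nat set \<Rightarrow> (('f, 'r, 'u) fm set \<Rightarrow> real) topology" where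
  "keisler_topology L U x =
     subtopology (product_topology (\<lambda>_. top_of_set {0..1}) (fm_algebra L U x))
       (keisler_measures L U x)"

definition finitely_satisfiable_in ::
    "('f, 'r) lang \<Rightarrow> ('f, 'r, 'u) struct \<Rightarrow> nat set \<Rightarrow> (('f, 'r, 'u) fm set \<Rightarrow> real)
       \<Rightarrow> ('f, 'r, 'u) struct \<Rightarrow> bool" where
  "finitely_satisfiable_in L U x \<mu> M \<longleftrightarrow>
     (\<forall>\<phi>\<in>formulas L (univ U) x. \<mu> (fm_class L U x \<phi>) > 0 \<longrightarrow>
        (\<exists>a\<in>tuples x (univ M). sat U a \<phi>))"

text \<open>All members of a class \<open>C\<close> of the algebra agree at \<open>a\<close>, so any representative will do.\<close>

definition dirac ::
    "('f, 'r) lang \<Rightarrow> ('f, 'r, 'u) struct \<Rightarrow> nat set \<Rightarrow> (nat \<Rightarrow> 'u)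
       \<Rightarrow> ('f, 'r, 'u) fm set \<Rightarrow> real" where
  "dirac L U x a = (\<lambda>C\<in>fm_algebra L U x. if \<exists>\<phi>\<in>C. sat U a \<phi> then 1 else 0)"

text \<open>
  Convex hulls of sets of measures are taken in the real vector space of all real-valued
  functions with pointwise operations. As the coefficients of a convex combination sum to 1,
  convex combinations of functions that are \<^const>\<open>undefined\<close> outside the algebra again have
  this property, so the hull of a set of Keisler measures consists of Keisler measures.
\<close>

instantiation "fun" :: (type, real_vector) real_vector
begin

definition scaleR_fun :: "real \<Rightarrow> ('a \<Rightarrow> 'b) \<Rightarrow> 'a \<Rightarrow> 'b" where
  "scaleR_fun c f = (\<lambda>z. c *\<^sub>R f z)"

instance
  by standard (simp_all add: scaleR_fun_def fun_eq_iff scaleR_add_right scaleR_add_left)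

end

definition conv_tuples ::
    "('f, 'r) lang \<Rightarrow> ('f, 'r, 'u) struct \<Rightarrow> nat set \<Rightarrow> ('f, 'r, 'u) struct
       \<Rightarrow> (('f, 'r, 'u) fm set \<Rightarrow> real) set" where
  "conv_tuples L U x M = convex hull (dirac L U x ` tuples x (univ M))"

end

theory Submission
  imports Defs
begin

text \<open>
  A measure in the closure of the convex hull of the point masses at tuples from \<open>M\<close> is finitely
  satisfiable in \<open>M\<close> because vanishing at a fixed formula is a closed convex condition: if it holds
  for all these point masses, it holds throughout the closure of their hull
  (\<open>realized_if_in_closure\<close>).

  Conversely, a neighbourhood of \<open>\<mu>\<close> only restricts the values at finitely many formulas, and these
  values can be attained exactly by a convex combination of point masses
  (\<open>ex_convex_combination_of_diracs\<close>). The finitely many formulas partition the space of tuples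
  into finitely many definable cells. If \<open>\<mu>\<close> is finitely satisfiable in \<open>M\<close>, every cell of positive
  measure contains a tuple from \<open>M\<close>, and moving the measure of the cell to that tuple does not change
  the measure of any of the given formulas, each being a union of cells. The cells
  need not be listed: an induction that refines the partition by one formula at a time, carried
  out on all restrictions of \<open>\<mu>\<close> to formulas at once, produces the combination
  (\<open>ex_conic_combination_of_diracs\<close>). As \<open>\<mu>\<close> has total mass \<open>1\<close>, the conic combination obtained
  for \<open>\<mu>\<close> itself is convex.
\<close>

section \<open>Classes of formulas and the values of measures on them\<close>

lemma scaleR_fun_apply [simp]: "(c *\<^sub>R f) z = c *\<^sub>R f z"
  by (simp add: scaleR_fun_def)

lemma formulas_connectives [simp]:
  "Bot \<in> formulas L A V"
  "Neg \<phi> \<in> formulas L A V \<longleftrightarrow> \<phi> \<in> formulas L A V"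
  "Disj \<phi> \<psi> \<in> formulas L A V \<longleftrightarrow> \<phi> \<in> formulas L A V \<and> \<psi> \<in> formulas L A V"
  by (auto simp: formulas_def)

lemma equiv_fm_equiv: "equiv (formulas L (univ U) x) (fm_equiv L U x)"
  by (auto simp: fm_equiv_def intro!: equivI refl_onI symI transI)

lemma fm_class_eq_iff:
  assumes "\<phi> \<in> formulas L (univ U) x" "\<psi> \<in> formulas L (univ U) x"
  shows "fm_class L U x \<phi> = fm_class L U x \<psi>
           \<longleftrightarrow> (\<forall>a\<in>tuples x (univ U). sat U a \<phi> \<longleftrightarrow> sat U a \<psi>)"
  unfolding fm_class_def eq_equiv_class_iff[OF equiv_fm_equiv assms]
  using assms by (simp add: fm_equiv_def)

lemma fm_class_in_fm_algebra:
  "\<phi> \<in> formulas L (univ U) x \<Longrightarrow> fm_class L U x \<phi> \<in> fm_algebra L U x"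
  by (simp add: fm_class_def fm_algebra_def quotientI)

lemma fm_algebraE:
  assumes "C \<in> fm_algebra L U x"
  obtains \<phi> where "\<phi> \<in> formulas L (univ U) x" "C = fm_class L U x \<phi>"
  using assms by (auto simp: fm_class_def fm_algebra_def elim: quotientE)

lemma dirac_fm_class:
  assumes "\<phi> \<in> formulas L (univ U) x" "a \<in> tuples x (univ U)"
  shows "dirac L U x a (fm_class L U x \<phi>) = (if sat U a \<phi> then 1 else 0)"
proof -
  have "(\<exists>\<psi>\<in>fm_class L U x \<phi>. sat U a \<psi>) \<longleftrightarrow> sat U a \<phi>"
    using assms by (auto simp: fm_class_def fm_equiv_def)
  then show ?thesis
    using assms by (simp add: dirac_def fm_class_in_fm_algebra)
qed

lemma keisler_measure_Top: "\<mu> \<in> keisler_measures L U x \<Longrightarrow> \<mu> (fm_class L U x Top) = 1"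
  by (simp add: keisler_measures_def)

lemma keisler_measure_nonneg:
  "\<mu> \<in> keisler_measures L U x \<Longrightarrow> \<phi> \<in> formulas L (univ U) x \<Longrightarrow> 0 \<le> \<mu> (fm_class L U x \<phi>)"
  using fm_class_in_fm_algebra by (fastforce simp: keisler_measures_def PiE_iff)

lemma keisler_measure_split:
  assumes \<mu>: "\<mu> \<in> keisler_measures L U x"
    and fms: "\<xi> \<in> formulas L (univ U) x" "\<phi> \<in> formulas L (univ U) x" "\<psi> \<in> formulas L (univ U) x"
    and cover: "\<And>a. a \<in> tuples x (univ U) \<Longrightarrow> sat U a \<xi> \<longleftrightarrow> sat U a \<phi> \<or> sat U a \<psi>"
    and disjoint: "\<And>a. a \<in> tuples x (univ U) \<Longrightarrow> \<not> (sat U a \<phi> \<and> sat U a \<psi>)"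
  shows "\<mu> (fm_class L U x \<xi>) = \<mu> (fm_class L U x \<phi>) + \<mu> (fm_class L U x \<psi>)"
proof -
  have "fm_class L U x (Conj \<phi> \<psi>) = fm_class L U x Bot"
    using fms disjoint by (simp add: fm_class_eq_iff)
  moreover have "fm_class L U x \<xi> = fm_class L U x (Disj \<phi> \<psi>)"
    using fms cover by (simp add: fm_class_eq_iff)
  ultimately show ?thesis
    using \<mu> fms by (simp add: keisler_measures_def)
qed

section \<open>The convex hull of the point masses consists of Keisler measures\<close>

lemma dirac_in_keisler_measures:
  assumes "a \<in> tuples x (univ U)"
  shows "dirac L U x a \<in> keisler_measures L U x"
  unfolding keisler_measures_def
proof (intro CollectI conjI ballI impI)
  show "dirac L U x a \<in> fm_algebra L U x \<rightarrow>\<^sub>E {0..1}"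
    by (auto simp: dirac_def)
  show "dirac L U x a (fm_class L U x Top) = 1"
    using assms by (simp add: dirac_fm_class)
next
  fix \<phi> \<psi>
  assume fms: "\<phi> \<in> formulas L (univ U) x" "\<psi> \<in> formulas L (univ U) x"
    and "fm_class L U x (Conj \<phi> \<psi>) = fm_class L U x Bot"
  then have "\<not> (sat U a \<phi> \<and> sat U a \<psi>)"
    using assms by (simp add: fm_class_eq_iff)
  then show "dirac L U x a (fm_class L U x (Disj \<phi> \<psi>))
      = dirac L U x a (fm_class L U x \<phi>) + dirac L U x a (fm_class L U x \<psi>)"
    using assms fms by (auto simp: dirac_fm_class)
qed

lemma convex_keisler_measures: "convex (keisler_measures L U x)"
proof (rule convexI)
  fix \<mu> \<nu> :: "('a, 'b, 'c) fm set \<Rightarrow> real" and s t :: real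
  assume \<mu>: "\<mu> \<in> keisler_measures L U x" and \<nu>: "\<nu> \<in> keisler_measures L U x"
    and st: "0 \<le> s" "0 \<le> t" "s + t = 1"
  let ?\<rho> = "s *\<^sub>R \<mu> + t *\<^sub>R \<nu>"
  have ext: "\<mu> \<in> fm_algebra L U x \<rightarrow>\<^sub>E {0..1}" "\<nu> \<in> fm_algebra L U x \<rightarrow>\<^sub>E {0..1}"
    using \<mu> \<nu> by (simp_all add: keisler_measures_def)
  have "?\<rho> \<in> fm_algebra L U x \<rightarrow>\<^sub>E {0..1}"
  proof (rule PiE_I)
    fix C assume "C \<in> fm_algebra L U x"
    then have "\<mu> C \<in> {0..1}" "\<nu> C \<in> {0..1}"
      using ext by (auto simp: PiE_iff)
    then have "s *\<^sub>R \<mu> C + t *\<^sub>R \<nu> C \<in> {0..1}"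
      using st by (intro convexD[OF convex_real_interval(5)]) auto
    then show "?\<rho> C \<in> {0..1}"
      by simp
  next
    fix C assume "C \<notin> fm_algebra L U x"
    then show "?\<rho> C = undefined"
      \<comment> \<open>The coefficients sum to \<open>1\<close>, so the default value is reproduced.\<close>
      using PiE_arb[OF ext(1)] PiE_arb[OF ext(2)] st(3) distrib_right[of s t undefined]
      by simp
  qed
  then show "?\<rho> \<in> keisler_measures L U x"
    using \<mu> \<nu> st by (simp add: keisler_measures_def algebra_simps)
qed

lemma convex_hull_diracs_subset_keisler_measures:
  assumes "A \<subseteq> univ U"
  shows "convex hull (dirac L U x ` tuples x A) \<subseteq> keisler_measures L U x"
proof (rule hull_minimal)
  show "convex (keisler_measures L U x)"
    by (rule convex_keisler_measures)
  have "tuples x A \<subseteq> tuples x (univ U)"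
    using assms by (auto simp: tuples_def PiE_iff)
  then show "dirac L U x ` tuples x A \<subseteq> keisler_measures L U x"
    by (auto intro: dirac_in_keisler_measures)
qed

section \<open>Realizing finitely many values of a measure by point masses\<close>

text \<open>
  When \<open>\<phi>\<close> is added to \<open>F\<close>, one splits \<open>\<theta>\<close> into \<open>\<theta> \<and> \<phi>\<close> and \<open>\<theta> \<and> \<not> \<phi>\<close> and adds the
  two combinations that the induction hypothesis gives for these formulas; this is the
  reason for the generality in \<open>\<theta>\<close>. Working with conic rather than convex combinations makes the
  pieces of measure zero harmless, as they contribute \<open>0\<close>. The formula \<^const>\<open>Top\<close> is included to
  record the total mass: for a combination of point masses at points of \<open>\<phi>\<close>, the value at \<open>\<phi>\<close> is
  that mass.
\<close>

lemma ex_conic_combination_of_diracs: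
  assumes \<mu>: "\<mu> \<in> keisler_measures L U x"
    and A: "A \<subseteq> univ U"
    and realized: "\<And>\<phi>. \<phi> \<in> formulas L (univ U) x \<Longrightarrow> \<mu> (fm_class L U x \<phi>) > 0
                    \<Longrightarrow> \<exists>a\<in>tuples x A. sat U a \<phi>"
    and "finite F" "F \<subseteq> formulas L (univ U) x" "\<theta> \<in> formulas L (univ U) x"
  shows "\<exists>g \<in> convex_cone hull (dirac L U x ` {a \<in> tuples x A. sat U a \<theta>}).
           \<forall>\<psi>\<in>insert Top F. g (fm_class L U x \<psi>) = \<mu> (fm_class L U x (Conj \<theta> \<psi>))"
  using assms(4-6)
proof (induction F arbitrary: \<theta> rule: finite_induct)
  case empty
  let ?c = "fm_class L U x"
  have *: "?c (Conj \<theta> Top) = ?c \<theta>"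
    using empty by (simp add: fm_class_eq_iff)
  show ?case
  proof (cases "\<mu> (?c \<theta>) = 0")
    case True
    then show ?thesis
      using * by (intro bexI[of _ 0] convex_cone_hull_contains_0) simp
  next
    case False
    then have pos: "\<mu> (?c \<theta>) > 0"
      using keisler_measure_nonneg[OF \<mu>] empty by (simp add: less_le)
    then obtain a where a: "a \<in> tuples x A" "sat U a \<theta>"
      using realized empty by blast
    then have "a \<in> tuples x (univ U)"
      using A by (auto simp: tuples_def PiE_iff)
    then show ?thesis
      using * pos a
      by (intro bexI[of _ "\<mu> (?c \<theta>) *\<^sub>R dirac L U x a"] convex_cone_hull_mul hull_inc)
        (auto simp: dirac_fm_class)
  qed
next
  case (insert \<phi> F)
  let ?c = "fm_class L U x"
  let ?K = "\<lambda>\<theta>. convex_cone hull (dirac L U x ` {a \<in> tuples x A. sat U a \<theta>})"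
  have tup: "a \<in> tuples x (univ U)" if "a \<in> tuples x A" for a
    using that A by (auto simp: tuples_def PiE_iff)
  have F: "F \<subseteq> formulas L (univ U) x" and \<phi>: "\<phi> \<in> formulas L (univ U) x"
    and \<theta>: "\<theta> \<in> formulas L (univ U) x"
    using insert.prems by auto
  obtain g where g: "g \<in> ?K (Conj \<theta> \<phi>)"
    and gF: "\<And>\<psi>. \<psi> \<in> insert Top F \<Longrightarrow> g (?c \<psi>) = \<mu> (?c (Conj (Conj \<theta> \<phi>) \<psi>))"
    using insert.IH[OF F, of "Conj \<theta> \<phi>"] \<phi> \<theta> by auto
  obtain h where h: "h \<in> ?K (Conj \<theta> (Neg \<phi>))"
    and hF: "\<And>\<psi>. \<psi> \<in> insert Top F \<Longrightarrow> h (?c \<psi>) = \<mu> (?c (Conj (Conj \<theta> (Neg \<phi>)) \<psi>))"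
    using insert.IH[OF F, of "Conj \<theta> (Neg \<phi>)"] \<phi> \<theta> by auto
  have g\<phi>: "g (?c \<phi>) = g (?c Top)"
    by (rule hull_induct[OF g])
      (auto simp: dirac_fm_class \<phi> tup convex_cone_iff)
  have h\<phi>: "h (?c \<phi>) = 0"
    by (rule hull_induct[OF h])
      (auto simp: dirac_fm_class \<phi> tup convex_cone_iff)
  have "g + h \<in> ?K \<theta>"
  proof (rule convex_cone_hull_add)
    show "g \<in> ?K \<theta>"
      by (rule subsetD[OF hull_mono g]) auto
    show "h \<in> ?K \<theta>"
      by (rule subsetD[OF hull_mono h]) auto
  qed
  moreover have "(g + h) (?c \<psi>) = \<mu> (?c (Conj \<theta> \<psi>))" if "\<psi> \<in> insert Top F" for \<psi>
  proof -
    have "\<psi> \<in> formulas L (univ U) x"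
      using that F by auto
    then have "\<mu> (?c (Conj \<theta> \<psi>))
        = \<mu> (?c (Conj (Conj \<theta> \<phi>) \<psi>)) + \<mu> (?c (Conj (Conj \<theta> (Neg \<phi>)) \<psi>))"
      using \<theta> \<phi> by (intro keisler_measure_split[OF \<mu>]) auto
    then show ?thesis
      using gF[OF that] hF[OF that] by simp
  qed
  moreover have "(g + h) (?c \<phi>) = \<mu> (?c (Conj \<theta> \<phi>))"
  proof -
    have "?c (Conj (Conj \<theta> \<phi>) Top) = ?c (Conj \<theta> \<phi>)"
      using \<theta> \<phi> by (simp add: fm_class_eq_iff)
    then show ?thesis
      using g\<phi> h\<phi> gF[of Top] by simp
  qed
  ultimately show ?case
    by blast
qed

lemma ex_convex_combination_of_diracs:
  assumes \<mu>: "\<mu> \<in> keisler_measures L U x"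
    and A: "A \<subseteq> univ U"
    and realized: "\<And>\<phi>. \<phi> \<in> formulas L (univ U) x \<Longrightarrow> \<mu> (fm_class L U x \<phi>) > 0
                    \<Longrightarrow> \<exists>a\<in>tuples x A. sat U a \<phi>"
    and "finite F" "F \<subseteq> formulas L (univ U) x"
  shows "\<exists>\<nu> \<in> convex hull (dirac L U x ` tuples x A).
           \<forall>\<psi>\<in>F. \<nu> (fm_class L U x \<psi>) = \<mu> (fm_class L U x \<psi>)"
proof -
  let ?c = "fm_class L U x" and ?D = "dirac L U x ` tuples x A"
  have top: "?c (Conj Top \<psi>) = ?c \<psi>" if "\<psi> \<in> formulas L (univ U) x" for \<psi>
    using that by (simp add: fm_class_eq_iff)
  obtain \<nu> where \<nu>: "\<nu> \<in> convex_cone hull ?D"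
    and \<nu>F: "\<And>\<psi>. \<psi> \<in> insert Top F \<Longrightarrow> \<nu> (?c \<psi>) = \<mu> (?c (Conj Top \<psi>))"
    using ex_conic_combination_of_diracs[OF assms, of Top] by auto
  have eq: "\<nu> (?c \<psi>) = \<mu> (?c \<psi>)" if "\<psi> \<in> insert Top F" for \<psi>
  proof -
    have "\<psi> \<in> formulas L (univ U) x"
      using that assms(5) by auto
    then show ?thesis
      using \<nu>F[OF that] by (simp only: top)
  qed
  then have mass: "\<nu> (?c Top) = 1"
    using keisler_measure_Top[OF \<mu>] by simp
  obtain c \<rho> where \<rho>: "\<rho> \<in> convex hull ?D" and c: "\<nu> = c *\<^sub>R \<rho>"
    using \<nu> mass unfolding convex_cone_hull_convex_hull by auto
  have "\<rho> (?c Top) = 1"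
    using \<rho> convex_hull_diracs_subset_keisler_measures[OF A] keisler_measure_Top by blast
  then have "\<nu> = \<rho>"
    using c mass by (simp add: fun_eq_iff)
  then show ?thesis
    using \<rho> eq by (intro bexI[of _ \<nu>]) simp_all
qed

section \<open>Finite satisfiability and closure\<close>

lemma topspace_keisler_topology: "topspace (keisler_topology L U x) = keisler_measures L U x"
  by (auto simp: keisler_topology_def keisler_measures_def)

lemma keisler_topology_eval_continuous:
  assumes "C \<in> fm_algebra L U x"
  shows "continuous_map (keisler_topology L U x) euclideanreal (\<lambda>\<mu>. \<mu> C)"
  unfolding keisler_topology_def
  using continuous_map_from_subtopology[OF continuous_map_product_projection[OF assms]]
  by (rule continuous_map_into_fulltopology)

text \<open>
  A basic open set of the product constrains only finitely many coordinates, so exact agreement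
  with \<open>\<mu>\<close> at finitely many formulas puts a measure into it.
\<close>

lemma keisler_topology_closure_ofI:
  assumes \<mu>: "\<mu> \<in> keisler_measures L U x"
    and S: "S \<subseteq> keisler_measures L U x"
    and approx: "\<And>F. finite F \<Longrightarrow> F \<subseteq> formulas L (univ U) x
      \<Longrightarrow> \<exists>\<nu>\<in>S. \<forall>\<psi>\<in>F. \<nu> (fm_class L U x \<psi>) = \<mu> (fm_class L U x \<psi>)"
  shows "\<mu> \<in> keisler_topology L U x closure_of S"
  unfolding in_closure_of
proof (intro conjI allI impI)
  show "\<mu> \<in> topspace (keisler_topology L U x)"
    using \<mu> by (simp add: topspace_keisler_topology)
next
  fix W assume "\<mu> \<in> W \<and> openin (keisler_topology L U x) W"
  then obtain V where V: "openin (product_topology (\<lambda>_. top_of_set {0..1}) (fm_algebra L U x)) V"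
    and W: "W = V \<inter> keisler_measures L U x" and "\<mu> \<in> V"
    by (auto simp: keisler_topology_def openin_subtopology)
  then obtain B where fin: "finite {C \<in> fm_algebra L U x. B C \<noteq> topspace (top_of_set {0..1::real})}"
    and \<mu>B: "\<mu> \<in> Pi\<^sub>E (fm_algebra L U x) B" and B: "Pi\<^sub>E (fm_algebra L U x) B \<subseteq> V"
    unfolding openin_product_topology_alt by blast
  have "{C \<in> fm_algebra L U x. B C \<noteq> topspace (top_of_set {0..1::real})}
      \<subseteq> fm_class L U x ` formulas L (univ U) x"
    by (auto elim: fm_algebraE)
  from finite_subset_image[OF fin this]
  obtain F where F: "F \<subseteq> formulas L (univ U) x" "finite F"
    and FB: "{C \<in> fm_algebra L U x. B C \<noteq> topspace (top_of_set {0..1::real})} = fm_class L U x ` F"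
    by (elim exE conjE) (rule that)
  obtain \<nu> where \<nu>: "\<nu> \<in> S" "\<And>\<psi>. \<psi> \<in> F \<Longrightarrow> \<nu> (fm_class L U x \<psi>) = \<mu> (fm_class L U x \<psi>)"
    using approx[OF F(2,1)] by blast
  have \<nu>E: "\<nu> \<in> fm_algebra L U x \<rightarrow>\<^sub>E {0..1}"
    using \<nu>(1) S by (auto simp: keisler_measures_def)
  have "\<nu> \<in> Pi\<^sub>E (fm_algebra L U x) B"
  proof (rule PiE_I)
    fix C assume C: "C \<in> fm_algebra L U x"
    show "\<nu> C \<in> B C"
    proof (cases "B C = topspace (top_of_set {0..1::real})")
      case True
      then show ?thesis
        using PiE_mem[OF \<nu>E C] by simp
    next
      case False
      then obtain \<psi> where "\<psi> \<in> F" "C = fm_class L U x \<psi>"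
        using FB C by blast
      then show ?thesis
        using \<nu>(2) \<mu>B C by (auto simp: PiE_iff)
    qed
  qed (rule PiE_arb[OF \<nu>E])
  then show "\<exists>\<nu>. \<nu> \<in> S \<and> \<nu> \<in> W"
    using \<nu>(1) B S W by blast
qed

text \<open>
  If no tuple from \<open>A\<close> satisfies \<open>\<phi>\<close>, all point masses at such tuples lie in the set of measures
  vanishing at \<open>\<phi>\<close>. This set is convex and closed, so it contains \<open>\<mu>\<close>.
\<close>

lemma realized_if_in_closure:
  assumes A: "A \<subseteq> univ U"
    and \<mu>: "\<mu> \<in> keisler_topology L U x closure_of (convex hull (dirac L U x ` tuples x A))"
    and \<phi>: "\<phi> \<in> formulas L (univ U) x" and pos: "\<mu> (fm_class L U x \<phi>) > 0"
  shows "\<exists>a\<in>tuples x A. sat U a \<phi>"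
proof (rule ccontr)
  assume unrealized: "\<not> (\<exists>a\<in>tuples x A. sat U a \<phi>)"
  let ?C = "fm_class L U x \<phi>"
  let ?Z = "{\<nu> \<in> keisler_measures L U x. \<nu> ?C \<in> {0}}"
  have tup: "a \<in> tuples x (univ U)" if "a \<in> tuples x A" for a
    using that A by (auto simp: tuples_def PiE_iff)
  have "convex {\<nu>. \<nu> ?C = (0::real)}"
    by (auto simp: convex_def)
  then have "convex hull (dirac L U x ` tuples x A) \<subseteq> {\<nu>. \<nu> ?C = 0}"
    using unrealized by (intro hull_minimal) (auto simp: dirac_fm_class \<phi> tup)
  then have "convex hull (dirac L U x ` tuples x A) \<subseteq> ?Z"
    using convex_hull_diracs_subset_keisler_measures[OF A] by blast
  moreover have "closedin (keisler_topology L U x) ?Z"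
    using closedin_continuous_map_preimage
      [OF keisler_topology_eval_continuous[OF fm_class_in_fm_algebra[OF \<phi>]], of "{0}"]
    by (simp add: topspace_keisler_topology)
  ultimately have "\<mu> \<in> ?Z"
    using \<mu> closure_of_minimal by blast
  with pos show False
    by simp
qed

theorem proposition2p11:
  fixes L :: "('f, 'r) lang"
    and T :: "('f, 'r, 'u) fm set"
    and U M :: "('f, 'r, 'u) struct"
    and \<kappa> :: "'k rel"
    and x :: "nat set"
    and \<mu> :: "('f, 'r, 'u) fm set \<Rightarrow> real"
  assumes "is_theory L T"
    and "is_model L T U"
    and "Card_order \<kappa>" "natLeq <o \<kappa>" "|symbols L| <o \<kappa>"
    and "saturated L \<kappa> U"
    and "finite x"
    and "\<mu> \<in> keisler_measures L U x"
    and "elementary_substruct L M U" "|univ M| <o \<kappa>"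
  shows "finitely_satisfiable_in L U x \<mu> M
     \<longleftrightarrow> \<mu> \<in> keisler_topology L U x closure_of conv_tuples L U x M"
proof
  have M: "univ M \<subseteq> univ U"
    using assms by (simp add: elementary_substruct_def)
  {
    assume fs: "finitely_satisfiable_in L U x \<mu> M"
    show "\<mu> \<in> keisler_topology L U x closure_of conv_tuples L U x M"
      unfolding conv_tuples_def
    proof (rule keisler_topology_closure_ofI)
      show "\<mu> \<in> keisler_measures L U x"
        by fact
      show "convex hull (dirac L U x ` tuples x (univ M)) \<subseteq> keisler_measures L U x"
        by (rule convex_hull_diracs_subset_keisler_measures[OF M])
      fix F assume F: "finite F" "F \<subseteq> formulas L (univ U) x"
      show "\<exists>\<nu>\<in>convex hull (dirac L U x ` tuples x (univ M)).
          \<forall>\<psi>\<in>F. \<nu> (fm_class L U x \<psi>) = \<mu> (fm_class L U x \<psi>)"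
      proof (rule ex_convex_combination_of_diracs[OF \<open>\<mu> \<in> keisler_measures L U x\<close> M _ F])
        fix \<phi> assume "\<phi> \<in> formulas L (univ U) x" "\<mu> (fm_class L U x \<phi>) > 0"
        then show "\<exists>a\<in>tuples x (univ M). sat U a \<phi>"
          using fs by (simp add: finitely_satisfiable_in_def)
      qed
    qed
  next
    assume "\<mu> \<in> keisler_topology L U x closure_of conv_tuples L U x M"
    then show "finitely_satisfiable_in L U x \<mu> M"
      using realized_if_in_closure[OF M]
      by (auto simp: finitely_satisfiable_in_def conv_tuples_def)
  }
qed

end
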